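(* Let $L$ be a locally compact Hausdorff space. Suppose $A$ is a C$^*$-algebra such that every weak-2-local derivation on $A$ is a (linear) derivation. Then every weak-2-local derivation on $C_0(L,A)$ is a (linear) derivation.
   Context: All C$^*$-algebras are complex. $C_0(L,A)$ is the C$^*$-algebra of all continuous functions $X:L\to A$ vanishing at infinity, with pointwise operations and the supremum norm. A derivation on a C$^*$-algebra $B$ is a linear map $D:B\to B$ with $D(ab)=D(a)b+aD(b)$ for all $a,b\in B$. A (not necessarily linear nor continuous) mapping $\Delta:B\to B$ is a weak-2-local derivation on $B$ if for every $x,y\in B$ and every $\phi$ in the dual space $B^*$ there is a derivation $D_{x,y,\phi}$ on $B$, depending on $x,y$ and $\phi$, such that $\phi(\Delta(x))=\phi(D_{x,y,\phi}(x))$ and $\phi(\Delta(y))=\phi(D_{x,y,\phi}(y))$. *)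

theory Defs
  imports "HOL-Analysis.Analysis"
begin

section \<open>Complex normed spaces and C*-algebras\<close>

text \<open>The real structure is kept as part of the classes, so that the results of HOL-Analysis apply;
  the first axiom ties it to the complex one.\<close>

class complex_normed_vector = real_normed_vector +
  fixes scaleC :: "complex \<Rightarrow> 'a \<Rightarrow> 'a"  (infixr "*\<^sub>C" 75)
  assumes scaleR_scaleC: "r *\<^sub>R x = complex_of_real r *\<^sub>C x"
    and scaleC_add_right: "a *\<^sub>C (x + y) = a *\<^sub>C x + a *\<^sub>C y"
    and scaleC_add_left: "(a + b) *\<^sub>C x = a *\<^sub>C x + b *\<^sub>C x"
    and scaleC_scaleC: "a *\<^sub>C b *\<^sub>C x = (a * b) *\<^sub>C x"
    and norm_scaleC: "norm (a *\<^sub>C x) = cmod a * norm x"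

instantiation complex :: complex_normed_vector
begin
definition scaleC_complex :: "complex \<Rightarrow> complex \<Rightarrow> complex"
  where "scaleC_complex = (*)"
instance
  by standard (auto simp: scaleC_complex_def algebra_simps scaleR_conv_of_real norm_mult)
end

text \<open>No unit is required: \<^class>\<open>real_normed_algebra\<close> is the class of (not necessarily unital)
  associative algebras with a submultiplicative norm.\<close>

class cstar_algebra = complex_normed_vector + real_normed_algebra + banach +
  fixes star :: "'a \<Rightarrow> 'a"
  assumes mult_scaleC_left: "(a *\<^sub>C x) * y = a *\<^sub>C (x * y)"
    and mult_scaleC_right: "x * (a *\<^sub>C y) = a *\<^sub>C (x * y)"
    and star_add: "star (x + y) = star x + star y"
    and star_scaleC: "star (a *\<^sub>C x) = cnj a *\<^sub>C star x"
    and star_mult: "star (x * y) = star y * star x"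
    and star_star: "star (star x) = x"
    and cstar_identity: "norm (star x * x) = (norm x)\<^sup>2"

instantiation complex :: cstar_algebra
begin
definition star_complex :: "complex \<Rightarrow> complex"
  where "star_complex = cnj"
instance
  by standard (auto simp: scaleC_complex_def star_complex_def algebra_simps norm_mult power2_eq_square)
end

lemma star_norm: "norm (star x) = norm (x::'a::cstar_algebra)"
proof -
  have le: "norm y \<le> norm (star y)" for y :: 'a
  proof (cases "norm y = 0")
    case False
    have "norm y * norm y \<le> norm (star y) * norm y"
      using norm_mult_ineq[of "star y" y] by (simp add: cstar_identity power2_eq_square)
    with False show ?thesis by simp
  qed simp
  from le[of x] le[of "star x"] show ?thesis by (simp add: star_star)
qed

lemma star_diff: "star (x - y) = star x - star (y::'a::cstar_algebra)"
  using star_add[of "x - y" y] by (simp add: algebra_simps)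

lemma bounded_linear_star: "bounded_linear (star :: 'a::cstar_algebra \<Rightarrow> 'a)"
  by (rule bounded_linear_intro[where K = 1])
     (simp_all add: star_add scaleR_scaleC star_scaleC star_norm)

lemma bounded_linear_scaleC: "bounded_linear (\<lambda>x::'a::complex_normed_vector. c *\<^sub>C x)"
  by (rule bounded_linear_intro[where K = "cmod c"])
     (simp_all add: scaleC_add_right scaleR_scaleC scaleC_scaleC norm_scaleC mult.commute)

definition complex_linear :: "('a::complex_normed_vector \<Rightarrow> 'b::complex_normed_vector) \<Rightarrow> bool"
  where "complex_linear f \<longleftrightarrow>
    (\<forall>x y. f (x + y) = f x + f y) \<and> (\<forall>c x. f (c *\<^sub>C x) = c *\<^sub>C f x)"

definition dual_space :: "('a::complex_normed_vector \<Rightarrow> complex) set"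
  where "dual_space = {\<phi>. complex_linear \<phi> \<and> continuous_on UNIV \<phi>}"


section \<open>Derivations and weak-2-local derivations\<close>

definition derivation :: "('a::cstar_algebra \<Rightarrow> 'a) \<Rightarrow> bool"
  where "derivation D \<longleftrightarrow> complex_linear D \<and> (\<forall>a b. D (a * b) = D a * b + a * D b)"

definition weak_2_local_derivation :: "('a::cstar_algebra \<Rightarrow> 'a) \<Rightarrow> bool"
  where "weak_2_local_derivation \<Delta> \<longleftrightarrow>
    (\<forall>x y. \<forall>\<phi>\<in>dual_space. \<exists>D. derivation D \<and> \<phi> (\<Delta> x) = \<phi> (D x) \<and> \<phi> (\<Delta> y) = \<phi> (D y))"


section \<open>The C*-algebra $C_0(L,A)$\<close>

definition vanishes_at_infinity :: "('l::topological_space \<Rightarrow> 'a::real_normed_vector) \<Rightarrow> bool"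
  where "vanishes_at_infinity f \<longleftrightarrow> (\<forall>e>0. \<exists>K. compact K \<and> (\<forall>t. t \<notin> K \<longrightarrow> norm (f t) < e))"

lemma vanishes_at_infinity_zero: "vanishes_at_infinity (\<lambda>_. 0)"
  unfolding vanishes_at_infinity_def by auto

lemma vanishes_at_infinity_add:
  assumes "vanishes_at_infinity f" "vanishes_at_infinity g"
  shows "vanishes_at_infinity (\<lambda>t. f t + g t)"
  unfolding vanishes_at_infinity_def
proof (intro allI impI)
  fix e :: real assume "e > 0"
  then have "e / 2 > 0" by simp
  then obtain K L where K: "compact K" "\<And>t. t \<notin> K \<Longrightarrow> norm (f t) < e / 2"
    and L: "compact L" "\<And>t. t \<notin> L \<Longrightarrow> norm (g t) < e / 2"
    using assms unfolding vanishes_at_infinity_def by meson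
  have "norm (f t + g t) < e" if "t \<notin> K \<union> L" for t
    using that K(2)[of t] L(2)[of t] norm_triangle_ineq[of "f t" "g t"] by simp
  with K(1) L(1) show "\<exists>K. compact K \<and> (\<forall>t. t \<notin> K \<longrightarrow> norm (f t + g t) < e)"
    by (intro exI[of _ "K \<union> L"]) auto
qed

lemma vanishes_at_infinity_le:
  assumes "vanishes_at_infinity f" "\<And>t. norm (g t) \<le> B * norm (f t)"
  shows "vanishes_at_infinity g"
  unfolding vanishes_at_infinity_def
proof (intro allI impI)
  fix e :: real assume e: "e > 0"
  define C where "C = max B 1"
  have C: "C > 0" "B \<le> C" by (auto simp: C_def)
  from e C(1) have "e / C > 0" by simp
  then obtain K where K: "compact K" "\<And>t. t \<notin> K \<Longrightarrow> norm (f t) < e / C"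
    using assms(1) unfolding vanishes_at_infinity_def by meson
  have "norm (g t) < e" if "t \<notin> K" for t
  proof -
    have "norm (g t) \<le> C * norm (f t)"
      using assms(2)[of t] mult_right_mono[OF C(2), of "norm (f t)"] by simp
    also have "\<dots> < e" using K(2)[OF that] C(1) by (simp add: field_simps)
    finally show ?thesis .
  qed
  with K(1) show "\<exists>K. compact K \<and> (\<forall>t. t \<notin> K \<longrightarrow> norm (g t) < e)" by blast
qed

lemma vanishes_at_infinity_bounded:
  fixes f :: "'l::topological_space \<Rightarrow> 'a::real_normed_vector"
  assumes "continuous_on UNIV f" "vanishes_at_infinity f"
  shows "bounded (range f)"
proof -
  obtain K where K: "compact K" "\<And>t. t \<notin> K \<Longrightarrow> norm (f t) < 1"
    using assms(2) unfolding vanishes_at_infinity_def by (meson zero_less_one)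
  have "bounded (f ` K)"
    using K(1) assms(1) by (meson compact_continuous_image compact_imp_bounded continuous_on_subset subset_UNIV)
  moreover have "bounded (f ` (- K))"
    using K(2) by (auto intro!: boundedI[where B = 1] less_imp_le)
  ultimately have "bounded (f ` K \<union> f ` (- K))" by simp
  then show ?thesis by (simp add: image_Un[symmetric])
qed

text \<open>Neither local compactness nor the Hausdorff property of the domain is needed for this
  construction to yield a C*-algebra.\<close>

typedef (overloaded) ('l::topological_space, 'a::real_normed_vector) C0 =
  "{f::'l \<Rightarrow> 'a. continuous_on UNIV f \<and> vanishes_at_infinity f}"
  morphisms apply_C0 Abs_C0
  by (rule exI[of _ "\<lambda>_. 0"]) (simp add: vanishes_at_infinity_zero)

setup_lifting type_definition_C0

lemma C0_eqI: "(\<And>t. apply_C0 f t = apply_C0 g t) \<Longrightarrow> f = g"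
  by transfer auto

lemma continuous_apply_C0: "continuous_on S (apply_C0 f)"
  using apply_C0[of f] by (auto intro: continuous_on_subset)

lemma vanishes_apply_C0: "vanishes_at_infinity (apply_C0 f)"
  using apply_C0[of f] by auto

lemma bdd_above_norm_C0: "bdd_above (range (\<lambda>t. norm (apply_C0 f t)))"
  using vanishes_at_infinity_bounded[OF continuous_apply_C0 vanishes_apply_C0, of f]
  by (auto simp: bounded_iff bdd_above_def)

instantiation C0 :: (topological_space, real_normed_vector) real_vector
begin

lift_definition zero_C0 :: "('a, 'b) C0" is "\<lambda>_. 0"
  by (simp add: vanishes_at_infinity_zero)

lift_definition plus_C0 :: "('a, 'b) C0 \<Rightarrow> ('a, 'b) C0 \<Rightarrow> ('a, 'b) C0" is "\<lambda>f g t. f t + g t"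
  by (auto intro!: continuous_intros vanishes_at_infinity_add)

lift_definition uminus_C0 :: "('a, 'b) C0 \<Rightarrow> ('a, 'b) C0" is "\<lambda>f t. - f t"
  by (auto intro!: continuous_intros elim: vanishes_at_infinity_le[where B = 1])

lift_definition minus_C0 :: "('a, 'b) C0 \<Rightarrow> ('a, 'b) C0 \<Rightarrow> ('a, 'b) C0" is "\<lambda>f g t. f t - g t"
proof -
  fix f g :: "'a \<Rightarrow> 'b"
  assume f: "continuous_on UNIV f \<and> vanishes_at_infinity f"
    and g: "continuous_on UNIV g \<and> vanishes_at_infinity g"
  have "vanishes_at_infinity (\<lambda>t. - g t)"
    using g by (auto elim: vanishes_at_infinity_le[where B = 1])
  with f have "vanishes_at_infinity (\<lambda>t. f t + - g t)"
    by (intro vanishes_at_infinity_add) auto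
  with f g show "continuous_on UNIV (\<lambda>t. f t - g t) \<and> vanishes_at_infinity (\<lambda>t. f t - g t)"
    by (auto intro!: continuous_intros)
qed

lift_definition scaleR_C0 :: "real \<Rightarrow> ('a, 'b) C0 \<Rightarrow> ('a, 'b) C0" is "\<lambda>r f t. r *\<^sub>R f t"
  subgoal for r f by (auto intro!: continuous_intros elim: vanishes_at_infinity_le[where B = "\<bar>r\<bar>"])
  done

instance
proof
  fix f g :: "('a, 'b) C0" and r s :: real
  show "f + g + h = f + (g + h)" for h :: "('a, 'b) C0" by transfer (simp add: add.assoc)
  show "f + g = g + f" by transfer (simp add: add.commute)
  show "0 + f = f" by transfer simp
  show "- f + f = 0" by transfer simp
  show "f - g = f + - g" by transfer simp
  show "r *\<^sub>R (f + g) = r *\<^sub>R f + r *\<^sub>R g" by transfer (simp add: scaleR_add_right)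
  show "(r + s) *\<^sub>R f = r *\<^sub>R f + s *\<^sub>R f" by transfer (simp add: scaleR_add_left)
  show "r *\<^sub>R s *\<^sub>R f = (r * s) *\<^sub>R f" by transfer simp
  show "1 *\<^sub>R f = f" by transfer simp
qed

end

instantiation C0 :: (topological_space, real_normed_vector) real_normed_vector
begin

definition norm_C0 :: "('a, 'b) C0 \<Rightarrow> real"
  where "norm_C0 f = (SUP t. norm (apply_C0 f t))"

definition dist_C0 :: "('a, 'b) C0 \<Rightarrow> ('a, 'b) C0 \<Rightarrow> real"
  where "dist_C0 f g = norm (f - g)"

definition sgn_C0 :: "('a, 'b) C0 \<Rightarrow> ('a, 'b) C0"
  where "sgn_C0 f = f /\<^sub>R norm f"

definition uniformity_C0 :: "(('a, 'b) C0 \<times> ('a, 'b) C0) filter"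
  where "uniformity_C0 = (INF e\<in>{0 <..}. principal {(x, y). dist x y < e})"

definition open_C0 :: "('a, 'b) C0 set \<Rightarrow> bool"
  where "open_C0 S = (\<forall>x\<in>S. \<forall>\<^sub>F (x', y) in uniformity. x' = x \<longrightarrow> y \<in> S)"

lemma norm_C0_upper: "norm (apply_C0 f t) \<le> norm f" for f :: "('a, 'b) C0"
  unfolding norm_C0_def by (rule cSUP_upper[OF _ bdd_above_norm_C0]) simp

lemma norm_C0_least: "(\<And>t. norm (apply_C0 f t) \<le> b) \<Longrightarrow> norm f \<le> b" for f :: "('a, 'b) C0"
  unfolding norm_C0_def by (rule cSUP_least) auto

instance
proof
  fix f g :: "('a, 'b) C0" and r :: real
  show "dist f g = norm (f - g)" by (rule dist_C0_def)
  show "sgn f = f /\<^sub>R norm f" by (rule sgn_C0_def)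
  show "(uniformity :: (('a, 'b) C0 \<times> ('a, 'b) C0) filter)
      = (INF e\<in>{0 <..}. principal {(x, y). dist x y < e})"
    by (rule uniformity_C0_def)
  show "open U = (\<forall>x\<in>U. \<forall>\<^sub>F (x', y) in uniformity. x' = x \<longrightarrow> y \<in> U)" for U :: "('a, 'b) C0 set"
    by (rule open_C0_def)
  have nonneg: "0 \<le> norm h" for h :: "('a, 'b) C0"
    using norm_C0_upper[of h undefined] norm_ge_zero order_trans by blast
  show "norm f = 0 \<longleftrightarrow> f = 0"
  proof
    assume "norm f = 0"
    then have "apply_C0 f t = 0" for t using norm_C0_upper[of f t] by simp
    then show "f = 0" by (intro C0_eqI) (simp add: zero_C0.rep_eq)
  next
    assume "f = 0"
    then have "norm f \<le> 0" by (intro norm_C0_least) (simp add: zero_C0.rep_eq)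
    with nonneg[of f] show "norm f = 0" by simp
  qed
  show "norm (f + g) \<le> norm f + norm g"
    by (rule norm_C0_least)
       (auto simp: plus_C0.rep_eq intro!: norm_triangle_le add_mono norm_C0_upper)
  have le: "norm (q *\<^sub>R h) \<le> \<bar>q\<bar> * norm h" for q and h :: "('a, 'b) C0"
    by (rule norm_C0_least) (auto simp: scaleR_C0.rep_eq intro!: mult_left_mono norm_C0_upper)
  show "norm (r *\<^sub>R f) = \<bar>r\<bar> * norm f"
  proof (cases "r = 0")
    case True
    then show ?thesis using le[of r f] nonneg[of "r *\<^sub>R f"] by simp
  next
    case False
    have "inverse r *\<^sub>R r *\<^sub>R f = f" using False by transfer auto
    with le[of "inverse r" "r *\<^sub>R f"] False have "\<bar>r\<bar> * norm f \<le> norm (r *\<^sub>R f)"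
      by (simp add: field_simps)
    with le[of r f] show ?thesis by simp
  qed
qed

end

instance C0 :: (topological_space, "{real_normed_vector, complete_space}") banach
proof
  fix F :: "nat \<Rightarrow> ('a, 'b) C0"
  assume F: "Cauchy F"
  have diff: "norm (apply_C0 f t - apply_C0 g t) \<le> norm (f - g)" for f g :: "('a, 'b) C0" and t
    using norm_C0_upper[of "f - g" t] by (simp add: minus_C0.rep_eq)
  have "Cauchy (\<lambda>n. apply_C0 (F n) t)" for t
    using F diff unfolding Cauchy_def dist_norm by (meson order_le_less_trans)
  then have "convergent (\<lambda>n. apply_C0 (F n) t)" for t by (rule Cauchy_convergent)
  then obtain g where g: "\<And>t. (\<lambda>n. apply_C0 (F n) t) \<longlonglongrightarrow> g t"
    unfolding convergent_def by metis
  have unif: "\<exists>N. \<forall>n\<ge>N. \<forall>t. norm (apply_C0 (F n) t - g t) \<le> e" if "e > 0" for e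
  proof -
    from F that obtain N where N: "\<And>m n. m \<ge> N \<Longrightarrow> n \<ge> N \<Longrightarrow> norm (F m - F n) < e"
      unfolding Cauchy_def dist_norm by blast
    have "norm (apply_C0 (F n) t - g t) \<le> e" if n: "n \<ge> N" for n t
    proof (rule tendsto_upperbound)
      show "(\<lambda>m. norm (apply_C0 (F n) t - apply_C0 (F m) t)) \<longlonglongrightarrow> norm (apply_C0 (F n) t - g t)"
        by (intro tendsto_intros g)
      show "\<forall>\<^sub>F m in sequentially. norm (apply_C0 (F n) t - apply_C0 (F m) t) \<le> e"
        unfolding eventually_sequentially
        using N[OF n] diff[of "F n" t] by (meson less_imp_le order_trans)
    qed simp
    then show ?thesis by blast
  qed
  have "uniform_limit UNIV (\<lambda>n. apply_C0 (F n)) g sequentially"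
    unfolding uniform_limit_sequentially_iff dist_norm
  proof (intro allI impI)
    fix e :: real assume "e > 0"
    then obtain N where N: "\<And>n t. n \<ge> N \<Longrightarrow> norm (apply_C0 (F n) t - g t) \<le> e / 2"
      using unif[of "e / 2"] by auto
    have "norm (apply_C0 (F n) x - g x) < e" if "n \<ge> N" for n x
      using N[OF that, of x] \<open>e > 0\<close> by simp
    then show "\<exists>N. \<forall>n\<ge>N. \<forall>x\<in>UNIV. norm (apply_C0 (F n) x - g x) < e" by blast
  qed
  then have cont: "continuous_on UNIV g"
    by (rule uniform_limit_theorem[rotated]) (auto simp: continuous_apply_C0)
  have "vanishes_at_infinity g"
    unfolding vanishes_at_infinity_def
  proof (intro allI impI)
    fix e :: real assume e: "e > 0"
    then obtain N where N: "\<And>t. norm (apply_C0 (F N) t - g t) \<le> e / 2"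
      using unif[of "e / 2"] by auto
    obtain K where K: "compact K" "\<And>t. t \<notin> K \<Longrightarrow> norm (apply_C0 (F N) t) < e / 2"
      using e vanishes_apply_C0[of "F N"] unfolding vanishes_at_infinity_def by (meson half_gt_zero)
    have "norm (g t) < e" if "t \<notin> K" for t
      using N[of t] K(2)[OF that] norm_triangle_ineq2[of "g t" "apply_C0 (F N) t"]
      by (simp add: norm_minus_commute)
    with K(1) show "\<exists>K. compact K \<and> (\<forall>t. t \<notin> K \<longrightarrow> norm (g t) < e)" by blast
  qed
  with cont obtain G where G: "apply_C0 G = g"
    using Abs_C0_inverse by blast
  have "F \<longlonglongrightarrow> G"
    unfolding lim_sequentially dist_norm
  proof (intro allI impI)
    fix e :: real assume e: "e > 0"
    then obtain N where N: "\<And>n t. n \<ge> N \<Longrightarrow> norm (apply_C0 (F n) t - g t) \<le> e / 2"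
      using unif[of "e / 2"] by auto
    have *: "norm (F n - G) \<le> e / 2" if "n \<ge> N" for n
      by (rule norm_C0_least, unfold minus_C0.rep_eq G, rule N[OF that])
    with e show "\<exists>N. \<forall>n\<ge>N. norm (F n - G) < e"
      by (intro exI[of _ N] allI impI order_le_less_trans[OF *]) auto
  qed
  then show "convergent F" by (rule convergentI)
qed

instantiation C0 :: (topological_space, complex_normed_vector) complex_normed_vector
begin

lift_definition scaleC_C0 :: "complex \<Rightarrow> ('a, 'b) C0 \<Rightarrow> ('a, 'b) C0" is "\<lambda>c f t. c *\<^sub>C f t"
  subgoal for c f
    by (auto intro!: bounded_linear.continuous_on[OF bounded_linear_scaleC] simp: norm_scaleC
        elim: vanishes_at_infinity_le[where B = "cmod c"])
  done

instance
proof
  fix f g :: "('a, 'b) C0" and a b :: complex and r :: real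
  show "r *\<^sub>R f = complex_of_real r *\<^sub>C f" by transfer (simp add: scaleR_scaleC)
  show "a *\<^sub>C (f + g) = a *\<^sub>C f + a *\<^sub>C g" by transfer (simp add: scaleC_add_right)
  show "(a + b) *\<^sub>C f = a *\<^sub>C f + b *\<^sub>C f" by transfer (simp add: scaleC_add_left)
  show "a *\<^sub>C b *\<^sub>C f = (a * b) *\<^sub>C f" by transfer (simp add: scaleC_scaleC)
  have one: "1 *\<^sub>C x = x" for x :: 'b using scaleR_scaleC[of 1 x] by simp
  have le: "norm (q *\<^sub>C h) \<le> cmod q * norm h" for q and h :: "('a, 'b) C0"
    by (rule norm_C0_least)
       (auto simp: scaleC_C0.rep_eq norm_scaleC intro!: mult_left_mono norm_C0_upper)
  show "norm (a *\<^sub>C f) = cmod a * norm f"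
  proof (cases "a = 0")
    case True
    then show ?thesis using le[of a f] by simp
  next
    case False
    have "inverse a *\<^sub>C a *\<^sub>C f = f"
      using False by transfer (simp add: scaleC_scaleC one)
    with le[of "inverse a" "a *\<^sub>C f"] False have "cmod a * norm f \<le> norm (a *\<^sub>C f)"
      by (simp add: field_simps norm_divide)
    with le[of a f] show ?thesis by simp
  qed
qed

end

instantiation C0 :: (topological_space, cstar_algebra) cstar_algebra
begin

lift_definition times_C0 :: "('a, 'b) C0 \<Rightarrow> ('a, 'b) C0 \<Rightarrow> ('a, 'b) C0" is "\<lambda>f g t. f t * g t"
proof -
  fix f g :: "'a \<Rightarrow> 'b"
  assume f: "continuous_on UNIV f \<and> vanishes_at_infinity f"
    and g: "continuous_on UNIV g \<and> vanishes_at_infinity g"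
  obtain B where B: "\<And>t. norm (f t) \<le> B"
    using vanishes_at_infinity_bounded[of f] f by (auto simp: bounded_iff)
  have "norm (f t * g t) \<le> B * norm (g t)" for t
    using norm_mult_ineq[of "f t" "g t"] mult_right_mono[OF B, of "norm (g t)" t] by simp
  with g have "vanishes_at_infinity (\<lambda>t. f t * g t)"
    by (blast intro: vanishes_at_infinity_le)
  with f g show "continuous_on UNIV (\<lambda>t. f t * g t) \<and> vanishes_at_infinity (\<lambda>t. f t * g t)"
    by (auto intro!: continuous_intros)
qed

lift_definition star_C0 :: "('a, 'b) C0 \<Rightarrow> ('a, 'b) C0" is "\<lambda>f t. star (f t)"
  by (auto intro!: bounded_linear.continuous_on[OF bounded_linear_star] simp: star_norm
      elim: vanishes_at_infinity_le[where B = 1])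

instance
proof
  fix f g h :: "('a, 'b) C0" and a :: complex and r :: real
  show "f * g * h = f * (g * h)" by transfer (simp add: mult.assoc)
  show "(f + g) * h = f * h + g * h" by transfer (simp add: distrib_right)
  show "f * (g + h) = f * g + f * h" by transfer (simp add: distrib_left)
  show "(r *\<^sub>R f) * g = r *\<^sub>R (f * g)" by transfer simp
  show "f * (r *\<^sub>R g) = r *\<^sub>R (f * g)" by transfer simp
  show mult: "norm (f * g) \<le> norm f * norm g" for f g :: "('a, 'b) C0"
    by (rule norm_C0_least)
       (auto simp: times_C0.rep_eq intro!: order_trans[OF norm_mult_ineq] mult_mono norm_C0_upper)
  show "(a *\<^sub>C f) * g = a *\<^sub>C (f * g)" by transfer (simp add: mult_scaleC_left)
  show "f * (a *\<^sub>C g) = a *\<^sub>C (f * g)" by transfer (simp add: mult_scaleC_right)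
  show "star (f + g) = star f + star g" by transfer (simp add: star_add)
  show "star (a *\<^sub>C f) = cnj a *\<^sub>C star f" by transfer (simp add: star_scaleC)
  show "star (f * g) = star g * star f" by transfer (simp add: star_mult)
  show "star (star f) = f" by transfer (simp add: star_star)
  have star_le: "norm (star f) \<le> norm f"
    by (rule norm_C0_least) (auto simp: star_C0.rep_eq star_norm intro: norm_C0_upper)
  have "(norm (apply_C0 f t))\<^sup>2 \<le> norm (star f * f)" for t
    using norm_C0_upper[of "star f * f" t] by (simp add: times_C0.rep_eq star_C0.rep_eq cstar_identity)
  then have "norm f \<le> sqrt (norm (star f * f))"
    by (intro norm_C0_least) (simp add: real_le_rsqrt)
  then have "(norm f)\<^sup>2 \<le> norm (star f * f)"
    using power_mono[of "norm f" "sqrt (norm (star f * f))" 2] by simp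
  moreover have "norm (star f * f) \<le> (norm f)\<^sup>2"
    using mult[of "star f" f] mult_right_mono[OF star_le, of "norm f"] by (simp add: power2_eq_square)
  ultimately show "norm (star f * f) = (norm f)\<^sup>2" by simp
qed

end

lifting_update C0.lifting
lifting_forget C0.lifting

end

theory Submission
  imports Defs
begin

text \<open>Every derivation \<open>D\<close> of \<open>C\<^sub>0(L,A)\<close> acts fibrewise. If \<open>X\<close> vanishes at \<open>t\<close>, write \<open>X = g W\<close>
  with a scalar function \<open>g\<close> and \<open>W\<close> both vanishing at \<open>t\<close>; expanding \<open>D (X Z) = D (W (g Z))\<close> at \<open>t\<close>
  gives \<open>D X t * Z t = 0\<close> for all \<open>Z\<close>, so \<open>D X t = 0\<close> by choosing \<open>Z = star (D X)\<close>. Hence a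
  weak-2-local derivation \<open>\<Delta>\<close> also acts fibrewise once the dual of \<open>A\<close> separates points, and on each
  fibre it is a weak-2-local derivation of \<open>A\<close>. No Hahn-Banach theorem is needed for the separation:
  a constant map whose value is killed by all functionals is a weak-2-local derivation, hence by
  the assumption on \<open>A\<close> linear, hence \<open>0\<close>.\<close>

lemmas apply_C0_simps = plus_C0.rep_eq minus_C0.rep_eq times_C0.rep_eq scaleC_C0.rep_eq
  star_C0.rep_eq zero_C0.rep_eq

lemma complex_linear_diff: "complex_linear f \<Longrightarrow> f (x - y) = f x - f y"
  unfolding complex_linear_def by (metis add_diff_cancel_right' diff_add_cancel)

lemma C0_obtain:
  assumes "continuous_on UNIV f" "vanishes_at_infinity f"
  obtains F where "\<And>t. apply_C0 F t = f t"
  using assms Abs_C0_inverse[of f] that[of "Abs_C0 f"] by simp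

text \<open>Only the origin is delicate: the quotient has norm \<open>sqrt (norm a)\<close>, which
  tends to 0 there, and its value at 0 is 0.\<close>

lemma continuous_on_divide_sqrt_norm:
  "continuous_on UNIV (\<lambda>a::'a::real_normed_vector. a /\<^sub>R sqrt (norm a))"
proof -
  have "isCont (\<lambda>a::'a. a /\<^sub>R sqrt (norm a)) a" for a
  proof (cases "a = 0")
    case True
    have "((\<lambda>a::'a. sqrt (norm a)) \<longlongrightarrow> sqrt (norm (0::'a))) (at 0)"
      by (intro tendsto_intros)
    moreover have "norm (b /\<^sub>R sqrt (norm b)) = sqrt (norm b)" for b :: 'a
      by (simp add: inverse_eq_divide real_div_sqrt)
    ultimately have "((\<lambda>a::'a. a /\<^sub>R sqrt (norm a)) \<longlongrightarrow> 0) (at 0)"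
      by (intro tendsto_norm_zero_cancel[of "\<lambda>a. a /\<^sub>R sqrt (norm a)"])
        (simp only: norm_zero real_sqrt_zero)
    with True show ?thesis by (simp add: isCont_def)
  qed (auto intro!: continuous_intros)
  then show ?thesis by (simp add: continuous_at_imp_continuous_on)
qed

text \<open>Dividing by the square root of the norm, rather than by the norm itself, leaves a
  continuous quotient that still vanishes wherever \<open>X\<close> does and at infinity.\<close>

lemma C0_factor:
  fixes X :: "('l::topological_space, 'a::real_normed_vector) C0"
  obtains W where "\<And>s. apply_C0 X s = sqrt (norm (apply_C0 X s)) *\<^sub>R apply_C0 W s"
    and "\<And>s. apply_C0 X s = 0 \<Longrightarrow> apply_C0 W s = 0"
proof -
  let ?w = "\<lambda>s. apply_C0 X s /\<^sub>R sqrt (norm (apply_C0 X s))"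
  have cont: "continuous_on UNIV ?w"
    using continuous_on_compose2[OF continuous_on_divide_sqrt_norm continuous_apply_C0] by simp
  have "vanishes_at_infinity ?w"
    unfolding vanishes_at_infinity_def
  proof (intro allI impI)
    fix e :: real assume e: "e > 0"
    \<comment> \<open>The bound is squared because \<open>norm (?w t)\<close> is the square root of
      \<open>norm (apply_C0 X t)\<close>.\<close>
    then obtain K where K: "compact K" "\<And>t. t \<notin> K \<Longrightarrow> norm (apply_C0 X t) < e\<^sup>2"
      using vanishes_apply_C0[of X] unfolding vanishes_at_infinity_def by (meson zero_less_power)
    have "norm (?w t) < e" if "t \<notin> K" for t
      using real_sqrt_less_mono[OF K(2)[OF that]] e
      by (simp add: inverse_eq_divide real_div_sqrt)
    with K(1) show "\<exists>K. compact K \<and> (\<forall>t. t \<notin> K \<longrightarrow> norm (?w t) < e)" by blast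
  qed
  with cont obtain W where "\<And>s. apply_C0 W s = ?w s" by (rule C0_obtain) blast
  then have "apply_C0 X s = sqrt (norm (apply_C0 X s)) *\<^sub>R apply_C0 W s"
    and "apply_C0 X s = 0 \<Longrightarrow> apply_C0 W s = 0" for s
    by (cases "apply_C0 X s = 0"; simp)+
  then show ?thesis by (rule that)
qed

lemma C0_scale:
  fixes X :: "('l::topological_space, 'a::real_normed_vector) C0"
  assumes "continuous_on UNIV g" "\<And>s. \<bar>g s\<bar> \<le> B"
  obtains Y where "\<And>s. apply_C0 Y s = g s *\<^sub>R apply_C0 X s"
proof (rule C0_obtain)
  show "continuous_on UNIV (\<lambda>s. g s *\<^sub>R apply_C0 X s)"
    using assms(1) by (intro continuous_intros continuous_apply_C0)
  show "vanishes_at_infinity (\<lambda>s. g s *\<^sub>R apply_C0 X s)"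
    using vanishes_apply_C0[of X]
    by (rule vanishes_at_infinity_le[where B = B]) (simp add: assms(2) mult_right_mono)
qed (use that in blast)

lemma derivation_C0_local:
  fixes D :: "('l::topological_space, 'a::cstar_algebra) C0 \<Rightarrow> ('l, 'a) C0"
  assumes D: "derivation D" and X: "apply_C0 X t = 0"
  shows "apply_C0 (D X) t = 0"
proof -
  let ?g = "\<lambda>s. sqrt (norm (apply_C0 X s))"
  define Z where "Z = star (D X)"
  obtain W where W: "\<And>s. apply_C0 X s = ?g s *\<^sub>R apply_C0 W s" "apply_C0 W t = 0"
    using C0_factor[of X] X by metis
  have "continuous_on UNIV ?g" by (intro continuous_intros continuous_apply_C0)
  moreover have "\<bar>?g s\<bar> \<le> sqrt (norm X)" for s by (simp add: norm_C0_upper)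
  ultimately obtain Y where Y: "\<And>s. apply_C0 Y s = ?g s *\<^sub>R apply_C0 Z s"
    by (rule C0_scale) blast
  \<comment> \<open>The scalar \<open>?g\<close> moves from the first factor to the second, so the
    product rule can be applied to two factorizations of the same element.\<close>
  have "X * Z = W * Y"
    by (rule C0_eqI, simp only: apply_C0_simps Y, subst W(1), simp)
  then have "D X * Z + X * D Z = D W * Y + W * D Y"
    using D unfolding derivation_def by metis
  then have "apply_C0 (D X * Z + X * D Z) t = apply_C0 (D W * Y + W * D Y) t" by simp
  \<comment> \<open>Three of the four terms vanish at \<open>t\<close>: \<open>X\<close> and
    \<open>W\<close> are zero there, and so is \<open>Y\<close> because
    \<open>?g t = 0\<close>.\<close>
  then have "apply_C0 (D X) t * star (apply_C0 (D X) t) = 0"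
    by (simp add: apply_C0_simps X W(2) Y Z_def)
  then show ?thesis
    using cstar_identity[of "star (apply_C0 (D X) t)"] by (simp add: star_star star_norm)
qed

lemma derivation_C0_cong:
  fixes D :: "('l::topological_space, 'a::cstar_algebra) C0 \<Rightarrow> ('l, 'a) C0"
  assumes D: "derivation D" and "apply_C0 X t = apply_C0 Y t"
  shows "apply_C0 (D X) t = apply_C0 (D Y) t"
  using derivation_C0_local[OF D, of "X - Y" t] assms complex_linear_diff[of D X Y]
  by (simp add: derivation_def apply_C0_simps)

text \<open>A Urysohn-type function \<open>f\<close> is 0 at \<open>t\<close> and 1 off a relatively
  compact neighbourhood; \<open>1 - f\<close> times the constant \<open>a\<close> is the extension.
  Local compactness and the Hausdorff property enter here.\<close>

lemma locally_compact_C0_extend: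
  fixes t :: "'l::t2_space"
  assumes lc: "locally_compact_space (euclidean :: 'l topology)"
  obtains E :: "'a::real_normed_vector \<Rightarrow> ('l, 'a) C0" where "\<And>a. apply_C0 (E a) t = a"
proof -
  obtain U K where UK: "open U" "compact K" "t \<in> U" "U \<subseteq> K"
    using lc unfolding locally_compact_space_def
    by (metis UNIV_I compactin_euclidean_iff open_openin topspace_euclidean)
  have "completely_regular_space (euclidean :: 'l topology)"
  proof (rule locally_compact_regular_imp_completely_regular_space[OF lc disjI1])
    show "Hausdorff_space (euclidean :: 'l topology)"
      by (simp add: Hausdorff_space_def disjnt_def) (metis hausdorff)
  qed
  moreover have "closedin euclidean (- U)" "t \<in> topspace euclidean - - U"
    using UK(1,3) by auto
  ultimately obtain f :: "'l \<Rightarrow> real" where "continuous_map euclidean (top_of_set {0..1}) f"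
    "f t = 0" "f ` (- U) \<subseteq> {1}"
    unfolding completely_regular_space_def by meson
  then have f: "continuous_on UNIV f" "f t = 0" "\<And>s. s \<notin> U \<Longrightarrow> f s = 1"
    by (auto simp: continuous_map_in_subtopology)
  have "\<exists>F. apply_C0 F t = a" for a :: 'a
  proof -
    have "continuous_on UNIV (\<lambda>s. (1 - f s) *\<^sub>R a)" by (intro continuous_intros f)
    moreover have "norm ((1 - f s) *\<^sub>R a) < e" if "e > 0" "s \<notin> K" for e s
    proof -
      have "f s = 1" using that UK(4) by (intro f(3)) auto
      with that show ?thesis by simp
    qed
    then have "vanishes_at_infinity (\<lambda>s. (1 - f s) *\<^sub>R a)"
      using UK(2) unfolding vanishes_at_infinity_def by meson
    ultimately obtain F where "\<And>s. apply_C0 F s = (1 - f s) *\<^sub>R a" by (rule C0_obtain) blast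
    then show ?thesis using f(2) by (intro exI[of _ F]) simp
  qed
  then show ?thesis using that by metis
qed

text \<open>Evaluation at \<open>t\<close> is linear and contractive, so functionals on the fibre
  pull back to \<open>C0\<close>.\<close>

lemma dual_space_eval_C0:
  assumes "\<phi> \<in> dual_space"
  shows "(\<lambda>X. \<phi> (apply_C0 X t)) \<in> dual_space"
proof -
  have "bounded_linear (\<lambda>X. apply_C0 X t)"
    by (rule bounded_linear_intro[where K = 1])
      (auto simp: plus_C0.rep_eq scaleR_C0.rep_eq norm_C0_upper)
  then show ?thesis
    using assms continuous_on_compose2[of UNIV \<phi> UNIV "\<lambda>X. apply_C0 X t"] linear_continuous_on
    by (auto simp: dual_space_def complex_linear_def apply_C0_simps)
qed

lemma derivation_zero: "derivation (\<lambda>_. 0)"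
proof -
  have "c *\<^sub>C (0::'a::cstar_algebra) = 0" for c
    using norm_scaleC[of c "0::'a"] by simp
  then show ?thesis by (simp add: derivation_def complex_linear_def)
qed

text \<open>\<open>E\<close> is a bare choice of extensions. \<open>E (a + b)\<close> and
  \<open>E a + E b\<close> may differ, but they agree at \<open>t\<close>, and \<open>D\<close> sees
  nothing else there; the same holds for scalar multiples and products.\<close>

lemma derivation_fibre:
  fixes D :: "('l::topological_space, 'a::cstar_algebra) C0 \<Rightarrow> ('l, 'a) C0"
  assumes D: "derivation D" and E: "\<And>a. apply_C0 (E a) t = a"
  shows "derivation (\<lambda>a. apply_C0 (D (E a)) t)"
proof -
  have "apply_C0 (D (E (a + b))) t = apply_C0 (D (E a + E b)) t" for a b
    by (rule derivation_C0_cong[OF D]) (simp add: E apply_C0_simps)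
  moreover have "apply_C0 (D (E (c *\<^sub>C a))) t = apply_C0 (D (c *\<^sub>C E a)) t" for c a
    by (rule derivation_C0_cong[OF D]) (simp add: E apply_C0_simps)
  moreover have "apply_C0 (D (E (a * b))) t = apply_C0 (D (E a * E b)) t" for a b
    by (rule derivation_C0_cong[OF D]) (simp add: E apply_C0_simps)
  ultimately show ?thesis
    using D by (simp add: derivation_def complex_linear_def apply_C0_simps E)
qed

lemma weak_2_local_derivation_fibre:
  fixes \<Delta> :: "('l::topological_space, 'a::cstar_algebra) C0 \<Rightarrow> ('l, 'a) C0"
  assumes \<Delta>: "weak_2_local_derivation \<Delta>" and E: "\<And>a. apply_C0 (E a) t = a"
  shows "weak_2_local_derivation (\<lambda>a. apply_C0 (\<Delta> (E a)) t)"
  unfolding weak_2_local_derivation_def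
proof (intro allI ballI)
  fix a b and \<phi> :: "'a \<Rightarrow> complex" assume "\<phi> \<in> dual_space"
  from dual_space_eval_C0[OF this, of t] \<Delta> obtain D where "derivation D"
    "\<phi> (apply_C0 (\<Delta> (E a)) t) = \<phi> (apply_C0 (D (E a)) t)"
    "\<phi> (apply_C0 (\<Delta> (E b)) t) = \<phi> (apply_C0 (D (E b)) t)"
    unfolding weak_2_local_derivation_def by meson
  then show "\<exists>D. derivation D \<and> \<phi> (apply_C0 (\<Delta> (E a)) t) = \<phi> (D a)
      \<and> \<phi> (apply_C0 (\<Delta> (E b)) t) = \<phi> (D b)"
    using derivation_fibre[of D E t] E by blast
qed

lemma dual_space_separates:
  fixes v :: "'a::cstar_algebra"
  assumes der: "\<forall>\<Delta> :: 'a \<Rightarrow> 'a. weak_2_local_derivation \<Delta> \<longrightarrow> derivation \<Delta>"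
    and v: "\<And>\<phi>. \<phi> \<in> dual_space \<Longrightarrow> \<phi> v = 0"
  shows "v = 0"
proof -
  have "\<phi> 0 = 0" if "\<phi> \<in> dual_space" for \<phi> :: "'a \<Rightarrow> complex"
    using complex_linear_diff[of \<phi> 0 0] that by (simp add: dual_space_def)
  \<comment> \<open>The zero derivation is a witness for every pair of points and every
    functional.\<close>
  then have "weak_2_local_derivation (\<lambda>_::'a. v)"
    using derivation_zero v unfolding weak_2_local_derivation_def by force
  then have "derivation (\<lambda>_::'a. v)" using der by blast
  then show "v = 0" by (simp add: derivation_def complex_linear_def)
qed

text \<open>The two-point condition is essential: a single \<open>D\<close> matches
  \<open>\<Delta>\<close> at both \<open>X\<close> and \<open>Y\<close> under the functional, and
  \<open>D\<close> cannot tell them apart at \<open>t\<close>.\<close>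

lemma weak_2_local_derivation_C0_cong:
  fixes \<Delta> :: "('l::topological_space, 'a::cstar_algebra) C0 \<Rightarrow> ('l, 'a) C0"
  assumes der: "\<forall>\<Delta> :: 'a \<Rightarrow> 'a. weak_2_local_derivation \<Delta> \<longrightarrow> derivation \<Delta>"
    and \<Delta>: "weak_2_local_derivation \<Delta>" and XY: "apply_C0 X t = apply_C0 Y t"
  shows "apply_C0 (\<Delta> X) t = apply_C0 (\<Delta> Y) t"
proof -
  have "\<phi> (apply_C0 (\<Delta> X) t - apply_C0 (\<Delta> Y) t) = 0" if \<phi>: "\<phi> \<in> dual_space" for \<phi>
  proof -
    from dual_space_eval_C0[OF \<phi>, of t] \<Delta> obtain D where "derivation D"
      "\<phi> (apply_C0 (\<Delta> X) t) = \<phi> (apply_C0 (D X) t)"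
      "\<phi> (apply_C0 (\<Delta> Y) t) = \<phi> (apply_C0 (D Y) t)"
      unfolding weak_2_local_derivation_def by meson
    then show ?thesis
      using derivation_C0_cong[of D X t Y] XY complex_linear_diff[of \<phi>] \<phi>
      by (simp add: dual_space_def)
  qed
  then show ?thesis
    using dual_space_separates[OF der, of "apply_C0 (\<Delta> X) t - apply_C0 (\<Delta> Y) t"] by simp
qed

theorem theorem2p6:
  assumes "locally_compact_space (euclidean :: 'l::t2_space topology)"
    and "\<forall>\<Delta> :: 'a::cstar_algebra \<Rightarrow> 'a. weak_2_local_derivation \<Delta> \<longrightarrow> derivation \<Delta>"
  shows "\<forall>\<Delta> :: ('l, 'a) C0 \<Rightarrow> ('l, 'a) C0. weak_2_local_derivation \<Delta> \<longrightarrow> derivation \<Delta>"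
proof (intro allI impI)
  fix \<Delta> :: "('l, 'a) C0 \<Rightarrow> ('l, 'a) C0"
  assume \<Delta>: "weak_2_local_derivation \<Delta>"
  have fibre: "\<exists>d. derivation d \<and> (\<forall>X. apply_C0 (\<Delta> X) t = d (apply_C0 X t))" for t
  proof -
    obtain E :: "'a \<Rightarrow> ('l, 'a) C0" where E: "\<And>a. apply_C0 (E a) t = a"
      using locally_compact_C0_extend[OF assms(1)] by blast
    have "derivation (\<lambda>a. apply_C0 (\<Delta> (E a)) t)"
      using weak_2_local_derivation_fibre[OF \<Delta> E] assms(2) by blast
    \<comment> \<open>Replacing \<open>X\<close> by the extension of its value at \<open>t\<close>
      turns the fibre map into one that computes \<open>\<Delta>\<close> for all
      \<open>X\<close>.\<close>
    moreover have "apply_C0 (\<Delta> X) t = apply_C0 (\<Delta> (E (apply_C0 X t))) t" for X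
      by (rule weak_2_local_derivation_C0_cong[OF assms(2) \<Delta>]) (simp add: E)
    ultimately show ?thesis by blast
  qed
  then obtain d where d: "\<And>t. derivation (d t)" "\<And>t X. apply_C0 (\<Delta> X) t = d t (apply_C0 X t)"
    by metis
  show "derivation \<Delta>"
    \<comment> \<open>The operations of \<open>C0\<close> are pointwise, so each identity reduces to
      the one for \<open>d t\<close>.\<close>
    unfolding derivation_def complex_linear_def
    using d(1) by (auto intro!: C0_eqI simp: d(2) apply_C0_simps derivation_def complex_linear_def)
qed

end
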